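(* Let $q>0$. There exist a martingale $(S(n),F(n))_{n\ge 1}$, $S(n)=\sum_{i=1}^n\xi(i)$, with martingale differences $\xi(i)$, and a constant $C_1\in(0,\infty)$ such that for all $x>0$ $$\inf_i T(\xi(i),x)\ge\exp(-x^q),\qquad \sup_i T(\xi(i),x)\le C_1\exp(-x^q),$$ and there exist finite positive constants $C_2,C_3$ such that for all $n=1,2,\dots$ $$Q_n(1)\ge C_2\exp\left(-C_3\,n^{q/(q+2)}\right).$$
   Context: Let $(\Omega,F,\mathbf P)$ be a probability space with a filtration $F(0)=\{\emptyset,\Omega\}$, $F(i)\subset F(i+1)\subset F$. Random variables $\xi(i)$ are martingale differences relative to $\{F(i)\}$ if $\mathbf E|\xi(i)|<\infty$, $\mathbf E\,\xi(i)=0$, $\xi(i)$ is $F(i)$-measurable, and $\mathbf E[\xi(i)\mid F(k)]=0$ a.s. for all $k=0,1,\dots,i-1$. Put $Q_n(x)=\mathbf P(S(n)/n>x)$ for $x>0$. For a random variable $\xi$ the tail-function is $T(\xi,x)=\max(\mathbf P(\xi\ge x),\mathbf P(\xi\le -x))$, $x\ge 0$.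
   Formalization: The lower bound inf_i T(ξ(i),x) ≥ exp(-x^q) is proved for all x ≥ x0, with x0 > 0 arbitrary but fixed in advance (martingale and constants may depend on x0), since for all x > 0 it contradicts E ξ(i) = 0 as x → 0. *)

theory Defs
  imports "HOL-Probability.Probability"
begin

definition tail :: "'a measure \<Rightarrow> ('a \<Rightarrow> real) \<Rightarrow> real \<Rightarrow> real" where
  "tail M X x = max (measure M {\<omega> \<in> space M. X \<omega> \<ge> x}) (measure M {\<omega> \<in> space M. X \<omega> \<le> - x})"

text \<open>
  The differences are indexed from 1 on; \<open>\<xi> 0\<close> is irrelevant. Each \<open>F i\<close> only
  serves as a sigma-algebra on the sample space; the probability is that of \<open>M\<close>.
\<close>

definition martingale_differences ::
    "'a measure \<Rightarrow> (nat \<Rightarrow> 'a measure) \<Rightarrow> (nat \<Rightarrow> 'a \<Rightarrow> real) \<Rightarrow> bool" where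
  "martingale_differences M F \<xi> \<longleftrightarrow>
     prob_space M \<and>
     filtration (space M) F \<and>
     sets (F 0) = {{}, space M} \<and>
     (\<forall>i. subalgebra M (F i)) \<and>
     (\<forall>i\<ge>1. integrable M (\<xi> i) \<and>
            integral\<^sup>L M (\<xi> i) = 0 \<and>
            \<xi> i \<in> borel_measurable (F i) \<and>
            (\<forall>k<i. AE \<omega> in M. real_cond_exp M (F k) (\<xi> i) \<omega> = 0))"

definition mart_sum :: "(nat \<Rightarrow> 'a \<Rightarrow> real) \<Rightarrow> nat \<Rightarrow> 'a \<Rightarrow> real" where
  "mart_sum \<xi> n \<omega> = (\<Sum>i=1..n. \<xi> i \<omega>)"

definition Q :: "'a measure \<Rightarrow> (nat \<Rightarrow> 'a \<Rightarrow> real) \<Rightarrow> nat \<Rightarrow> real \<Rightarrow> real" where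
  "Q M \<xi> n x = measure M {\<omega> \<in> space M. mart_sum \<xi> n \<omega> / real n > x}"

text \<open>
  The lower bound \<open>T(X, x) \<ge> exp (- x\<^sup>q)\<close> cannot hold for all \<open>x > 0\<close> if \<open>X\<close> has
  mean zero: letting \<open>x\<close> tend to 0 gives \<open>P (X > 0) = 1\<close> or \<open>P (X < 0) = 1\<close>. For this
  reason the main statement asserts the lower bound for \<open>x \<ge> x0\<close>, where \<open>x0 > 0\<close> is an
  arbitrary number given in advance.
\<close>

lemma no_tail_lower_bound_near_0:
  assumes "prob_space M" and int: "integrable M X" and mean: "integral\<^sup>L M X = 0" and q: "q > 0"
  shows "\<not> (\<forall>x>0. tail M X x \<ge> exp (- (x powr q)))"
proof
  assume *: "\<forall>x>0. tail M X x \<ge> exp (- (x powr q))"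
  interpret prob_space M by fact
  have [measurable]: "X \<in> borel_measurable M" using int by simp
  define a b where "a = prob {\<omega> \<in> space M. X \<omega> \<le> 0}" and "b = prob {\<omega> \<in> space M. X \<omega> \<ge> 0}"
  have bound: "exp (- (x powr q)) \<le> 1 - min a b" if "x > 0" for x
  proof -
    have "prob {\<omega> \<in> space M. X \<omega> \<ge> x} \<le> prob (space M - {\<omega> \<in> space M. X \<omega> \<le> 0})"
      using that by (intro finite_measure_mono) auto
    also have "\<dots> = 1 - a" unfolding a_def by (rule prob_compl) measurable
    finally have 1: "prob {\<omega> \<in> space M. X \<omega> \<ge> x} \<le> 1 - a" .
    have "prob {\<omega> \<in> space M. X \<omega> \<le> - x} \<le> prob (space M - {\<omega> \<in> space M. X \<omega> \<ge> 0})"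
      using that by (intro finite_measure_mono) auto
    also have "\<dots> = 1 - b" unfolding b_def by (rule prob_compl) measurable
    finally have 2: "prob {\<omega> \<in> space M. X \<omega> \<le> - x} \<le> 1 - b" .
    have "exp (- (x powr q)) \<le> tail M X x" using * that by blast
    with 1 2 show ?thesis by (auto simp: tail_def max_def min_def split: if_splits)
  qed
  have "((\<lambda>x::real. exp (- (x powr q))) \<longlongrightarrow> exp (- (0 powr q))) (at_right 0)"
    using q by (intro tendsto_intros tendsto_powr2) (auto simp: eventually_at_filter)
  moreover have "\<forall>\<^sub>F x::real in at_right 0. exp (- (x powr q)) \<le> 1 - min a b"
    using bound by (auto simp: eventually_at_filter)
  ultimately have "exp (- (0 powr q)) \<le> 1 - min a b"
    by (rule tendsto_upperbound) simp
  hence "min a b \<le> 0" by simp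
  hence "a = 0 \<or> b = 0"
    by (metis a_def b_def min_def measure_nonneg order_antisym)
  thus False
  proof
    assume "a = 0"
    hence ae: "AE \<omega> in M. X \<omega> > 0"
      by (subst AE_iff_measurable[where N="{\<omega> \<in> space M. X \<omega> \<le> 0}"])
         (auto simp: a_def emeasure_eq_measure not_less)
    have "AE \<omega> in M. 0 \<le> X \<omega>"
      using ae by eventually_elim simp
    hence "AE \<omega> in M. X \<omega> = 0"
      using integral_nonneg_eq_0_iff_AE[OF int] mean by blast
    with ae have "AE \<omega> in M. False" by eventually_elim auto
    thus False by simp
  next
    assume "b = 0"
    hence ae: "AE \<omega> in M. X \<omega> < 0"
      by (subst AE_iff_measurable[where N="{\<omega> \<in> space M. X \<omega> \<ge> 0}"])
         (auto simp: b_def emeasure_eq_measure not_less)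
    have "AE \<omega> in M. 0 \<le> - X \<omega>"
      using ae by eventually_elim simp
    hence "AE \<omega> in M. - X \<omega> = 0"
      using integral_nonneg_eq_0_iff_AE[of M "\<lambda>\<omega>. - X \<omega>"] mean int by simp
    with ae have "AE \<omega> in M. False" by eventually_elim auto
    thus False by simp
  qed
qed

end

theory Submission
  imports Defs
begin

text \<open>
  All differences carry one common random amplitude: \<open>\<xi> i = \<eta> \<epsilon> i\<close>, where the \<open>\<epsilon> i\<close> are fair
  signs, independent of each other and of \<open>\<eta>\<close>, and \<open>P (\<eta> \<ge> x) = 2 exp (- x\<^sup>q)\<close> for large \<open>x\<close>.
  Since \<open>\<eta>\<close> is known from time 1 on, this is a martingale.
  On the event \<open>\<eta> > x\<close> with \<open>x\<close> of order \<open>n\<close> to the power \<open>1 / (q + 2)\<close>, the sum exceeds \<open>n\<close>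
  as soon as the simple random walk exceeds \<open>n / x\<close>. Both of these events have probability at
  least \<open>exp (- C N)\<close>, where \<open>N\<close> is \<open>n\<close> to the power \<open>q / (q + 2)\<close>: for the walk this follows from
  the second moment method applied to \<open>exp (t S)\<close> with \<open>t\<close> of order \<open>1 / x\<close>.

  A symmetric \<open>\<xi> i\<close> cannot have a tail close to 1 at a small \<open>x0\<close>. Therefore \<open>\<eta> \<epsilon> i\<close> is used only
  when \<open>\<eta>\<close> is large; otherwise \<open>\<xi> i\<close> is a bounded, centred two-valued variable that
  is positive with probability close to 1.
\<close>

subsection \<open>Products of identical probability spaces\<close>

text \<open>The integrand sees only the coordinates in \<open>J\<close>, and the marginal of the
  infinite product on \<open>J\<close> is the finite product, where Fubini applies.\<close>

lemma integral_PiM_prod_coordinates: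
  fixes D :: "'a measure" and h :: "nat \<Rightarrow> 'a \<Rightarrow> real"
  assumes "prob_space D" and J: "finite J" and h: "\<And>i. i \<in> J \<Longrightarrow> integrable D (h i)"
  shows "integrable (PiM UNIV (\<lambda>_. D)) (\<lambda>\<omega>. \<Prod>i\<in>J. h i (\<omega> i))"
    and "(\<integral>\<omega>. (\<Prod>i\<in>J. h i (\<omega> i)) \<partial>PiM UNIV (\<lambda>_. D)) = (\<Prod>i\<in>J. \<integral>x. h i x \<partial>D)"
proof -
  interpret D: prob_space D by fact
  interpret P: product_prob_space "\<lambda>_::nat. D" UNIV by unfold_locales
  let ?f = "\<lambda>\<omega>. \<Prod>i\<in>J. h i (\<omega> i)"
  have r: "distr (PiM UNIV (\<lambda>_. D)) (PiM J (\<lambda>_. D)) (\<lambda>x. restrict x J) = PiM J (\<lambda>_. D)"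
    by (rule P.distr_PiM_restrict_finite) (use J in auto)
  have i: "integrable (PiM J (\<lambda>_. D)) ?f"
    using J h by (rule P.product_integrable_prod)
  from i have [measurable]: "?f \<in> borel_measurable (PiM J (\<lambda>_. D))" by simp
  have [measurable]: "(\<lambda>x. restrict x J) \<in> measurable (PiM UNIV (\<lambda>_. D)) (PiM J (\<lambda>_. D))"
    by (rule measurable_restrict_subset) auto
  have i': "integrable (distr (PiM UNIV (\<lambda>_. D)) (PiM J (\<lambda>_. D)) (\<lambda>x. restrict x J)) ?f"
    using i by (simp only: r)
  have e: "?f (restrict \<omega> J) = ?f \<omega>" for \<omega> by (intro prod.cong) auto
  show "integrable (PiM UNIV (\<lambda>_. D)) ?f"
    using i' by (subst (asm) integrable_distr_eq) (auto simp: e)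
  have "(\<integral>\<omega>. ?f \<omega> \<partial>PiM J (\<lambda>_. D)) = (\<integral>\<omega>. ?f \<omega> \<partial>PiM UNIV (\<lambda>_. D))"
    unfolding arg_cong[OF r, of "\<lambda>N. integral\<^sup>L N ?f", symmetric]
    using i by (subst integral_distr) (auto simp: e)
  thus "(\<integral>\<omega>. ?f \<omega> \<partial>PiM UNIV (\<lambda>_. D)) = (\<Prod>i\<in>J. \<integral>x. h i x \<partial>D)"
    using P.product_integral_prod[OF J h] by simp
qed

lemma prob_PiM_two_coordinates:
  fixes D :: "'a measure" and i j :: nat
  assumes "prob_space D" and "i \<noteq> j" and [measurable]: "A \<in> sets D" "B \<in> sets D"
  shows "measure (PiM UNIV (\<lambda>_. D)) {\<omega> \<in> space (PiM UNIV (\<lambda>_. D)). \<omega> i \<in> A \<and> \<omega> j \<in> B}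
    = measure D A * measure D B"
proof -
  interpret D: prob_space D by fact
  interpret P: product_prob_space "\<lambda>_::nat. D" UNIV by unfold_locales
  let ?h = "\<lambda>k. if k = i then A else B"
  have "{\<omega> \<in> space (PiM UNIV (\<lambda>_. D)). \<omega> i \<in> A \<and> \<omega> j \<in> B}
    = prod_emb UNIV (\<lambda>_. D) {i, j} (PiE {i, j} ?h)"
    using \<open>i \<noteq> j\<close> by (auto simp: prod_emb_def space_PiM PiE_iff)
  moreover have "measure (PiM UNIV (\<lambda>_. D)) (prod_emb UNIV (\<lambda>_. D) {i, j} (PiE {i, j} ?h))
     = (\<Prod>k\<in>{i, j}. measure D (?h k))"
    by (rule P.measure_PiM_emb) auto
  ultimately show ?thesis using \<open>i \<noteq> j\<close> by simp
qed

text \<open>Overwriting coordinate \<open>i\<close> by an independent draw from \<open>D\<close>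
  preserves the product measure; Fubini then integrates the new coordinate first. This plays the
  role of conditioning on all other coordinates.\<close>

lemma integral_PiM_resample:
  fixes D :: "'a measure" and i :: nat and f :: "(nat \<Rightarrow> 'a) \<Rightarrow> real"
  assumes "prob_space D" and f: "integrable (PiM UNIV (\<lambda>_. D)) f"
  shows "(\<integral>\<omega>. f \<omega> \<partial>PiM UNIV (\<lambda>_. D)) = (\<integral>\<omega>. (\<integral>x. f (fun_upd \<omega> i x) \<partial>D) \<partial>PiM UNIV (\<lambda>_. D))"
proof -
  let ?P = "PiM UNIV (\<lambda>_::nat. D)"
  interpret D: prob_space D by fact
  interpret P: product_prob_space "\<lambda>_::nat. D" UNIV by unfold_locales
  interpret pair_sigma_finite D ?P by unfold_locales
  have r: "distr (D \<Otimes>\<^sub>M ?P) ?P (\<lambda>(x, X). fun_upd X i x) = ?P"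
    using distr_pair_PiM_eq_PiM[of UNIV "\<lambda>_. D" i] D.prob_space_axioms by simp
  have m: "(\<lambda>(x, X). fun_upd X i x) \<in> measurable (D \<Otimes>\<^sub>M ?P) ?P"
    using measurable_fun_upd[of UNIV UNIV i snd "D \<Otimes>\<^sub>M ?P" "\<lambda>_. D" fst] by (simp add: case_prod_beta')
  have [measurable]: "f \<in> borel_measurable ?P" using f by simp
  have I: "integrable (D \<Otimes>\<^sub>M ?P) (\<lambda>(x, X). f (fun_upd X i x))"
    using f by (subst (asm) r[symmetric], subst (asm) integrable_distr_eq[OF m])
      (auto simp: case_prod_beta')
  have "(\<integral>\<omega>. f \<omega> \<partial>?P) = (\<integral>z. (\<lambda>(x, X). f (fun_upd X i x)) z \<partial>(D \<Otimes>\<^sub>M ?P))"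
    by (subst r[symmetric], subst integral_distr[OF m]) (auto simp: case_prod_beta')
  also have "\<dots> = (\<integral>\<omega>. (\<integral>x. f (fun_upd \<omega> i x) \<partial>D) \<partial>?P)"
    using integral_snd[OF I] by simp
  finally show ?thesis .
qed

text \<open>
  The filtration consists of the measurable sets that depend only on the given coordinates. This
  makes membership in the past invariant under resampling a later coordinate, and no
  coordinates at all give the trivial sigma-algebra.
\<close>

definition depends_on :: "('i \<Rightarrow> 'a) set \<Rightarrow> 'i set \<Rightarrow> ('i \<Rightarrow> 'a) set \<Rightarrow> bool" where
  "depends_on \<Omega> J A \<longleftrightarrow> (\<forall>\<omega>\<in>\<Omega>. \<forall>\<omega>'\<in>\<Omega>. (\<forall>j\<in>J. \<omega> j = \<omega>' j) \<longrightarrow> \<omega> \<in> A \<longrightarrow> \<omega>' \<in> A)"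

text \<open>The defining implication is symmetric in the two points, hence an equivalence; closure
  under complements rests on this.\<close>

lemma depends_onD:
  "depends_on \<Omega> J A \<Longrightarrow> \<omega> \<in> \<Omega> \<Longrightarrow> \<omega>' \<in> \<Omega> \<Longrightarrow> (\<And>j. j \<in> J \<Longrightarrow> \<omega> j = \<omega>' j) \<Longrightarrow> \<omega> \<in> A \<longleftrightarrow> \<omega>' \<in> A"
  unfolding depends_on_def by metis

lemma depends_on_mono: "depends_on \<Omega> I A \<Longrightarrow> I \<subseteq> J \<Longrightarrow> depends_on \<Omega> J A"
  unfolding depends_on_def by blast

lemma depends_on_empty: "depends_on \<Omega> {} A \<Longrightarrow> A \<subseteq> \<Omega> \<Longrightarrow> A = {} \<or> A = \<Omega>"
  unfolding depends_on_def by blast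

lemma sigma_algebra_depends_on:
  fixes M :: "('i \<Rightarrow> 'a) measure"
  shows "sigma_algebra (space M) {A \<in> sets M. depends_on (space M) J A}"
  unfolding sigma_algebra_iff2
proof (intro conjI ballI allI impI)
  show "{A \<in> sets M. depends_on (space M) J A} \<subseteq> Pow (space M)"
    using sets.sets_into_space by blast
  show "{} \<in> {A \<in> sets M. depends_on (space M) J A}"
    by (simp add: depends_on_def)
next
  fix A assume "A \<in> {A \<in> sets M. depends_on (space M) J A}"
  hence A: "A \<in> sets M" and dep: "depends_on (space M) J A" by auto
  have "depends_on (space M) J (space M - A)"
    unfolding depends_on_def using depends_onD[OF dep] by blast
  with A show "space M - A \<in> {A \<in> sets M. depends_on (space M) J A}" by blast
next
  fix A :: "nat \<Rightarrow> ('i \<Rightarrow> 'a) set"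
  assume "range A \<subseteq> {A \<in> sets M. depends_on (space M) J A}"
  hence A: "A n \<in> sets M" and dep: "depends_on (space M) J (A n)" for n by auto
  have "depends_on (space M) J (\<Union>n. A n)"
    unfolding depends_on_def
  proof (intro ballI impI)
    fix \<omega> \<omega>' assume "\<omega> \<in> space M" "\<omega>' \<in> space M" "\<forall>j\<in>J. \<omega> j = \<omega>' j" "\<omega> \<in> (\<Union>n. A n)"
    thus "\<omega>' \<in> (\<Union>n. A n)" using depends_onD[OF dep, of \<omega> \<omega>'] by blast
  qed
  moreover have "(\<Union>n. A n) \<in> sets M" using A by blast
  ultimately show "(\<Union>n. A n) \<in> {A \<in> sets M. depends_on (space M) J A}" by blast
qed

definition coordinate_sigma :: "('i \<Rightarrow> 'a) measure \<Rightarrow> 'i set \<Rightarrow> ('i \<Rightarrow> 'a) measure" where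
  "coordinate_sigma M J = sigma (space M) {A \<in> sets M. depends_on (space M) J A}"

lemma space_coordinate_sigma [simp]: "space (coordinate_sigma M J) = space M"
  by (simp add: coordinate_sigma_def space_measure_of_conv)

lemma sets_coordinate_sigma: "sets (coordinate_sigma M J) = {A \<in> sets M. depends_on (space M) J A}"
  using sigma_algebra_depends_on[of M J]
  by (simp add: coordinate_sigma_def sigma_algebra.sets_measure_of_eq)

lemma borel_measurable_coordinate_sigma:
  fixes f :: "('i \<Rightarrow> 'a) \<Rightarrow> real"
  assumes "f \<in> borel_measurable M"
    and eq: "\<And>\<omega> \<omega>'. (\<And>j. j \<in> J \<Longrightarrow> \<omega> j = \<omega>' j) \<Longrightarrow> f \<omega> = f \<omega>'"
  shows "f \<in> borel_measurable (coordinate_sigma M J)"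
proof (rule measurableI)
  fix B :: "real set" assume "B \<in> sets borel"
  with assms(1) have "f -` B \<inter> space M \<in> sets M" by (rule measurable_sets)
  moreover have "depends_on (space M) J (f -` B \<inter> space M)"
    unfolding depends_on_def by (metis IntE IntI eq vimage_eq)
  ultimately show "f -` B \<inter> space (coordinate_sigma M J) \<in> sets (coordinate_sigma M J)"
    by (simp add: sets_coordinate_sigma)
qed simp

text \<open>An event of time \<open>k < i\<close> does not see coordinate \<open>i\<close>, so after
  resampling that coordinate the inner integral is a multiple of the mean of
  \<open>g (\<omega> 0)\<close>, which vanishes. The condition \<open>0 < k\<close> empties the
  index set at time 0, whereas from time 1 on coordinate 0 is known.\<close>

lemma martingale_differences_iid:
  fixes D :: "real measure" and g :: "real \<Rightarrow> real \<Rightarrow> real"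
  assumes D: "prob_space D"
    and int: "\<And>i::nat. i \<ge> 1 \<Longrightarrow> integrable (PiM UNIV (\<lambda>_. D)) (\<lambda>\<omega>. g (\<omega> 0) (\<omega> i))"
    and mean: "\<And>u. (\<integral>v. g u v \<partial>D) = 0"
  shows "martingale_differences (PiM UNIV (\<lambda>_. D))
    (\<lambda>k. coordinate_sigma (PiM UNIV (\<lambda>_. D)) {j. 0 < k \<and> j \<le> k}) (\<lambda>i \<omega>. g (\<omega> 0) (\<omega> i))"
proof -
  let ?P = "PiM UNIV (\<lambda>_::nat. D)" and ?F = "\<lambda>k. coordinate_sigma (PiM UNIV (\<lambda>_. D)) {j. 0 < k \<and> j \<le> (k::nat)}"
  interpret D: prob_space D by fact
  interpret P: product_prob_space "\<lambda>_::nat. D" UNIV by unfold_locales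
  have sub: "subalgebra ?P (?F k)" for k
    by (auto simp: subalgebra_def sets_coordinate_sigma)
  have zero: "(LINT \<omega>:A|?P. g (\<omega> 0) (\<omega> i)) = 0" if "k < i" "A \<in> sets (?F k)" for k i A
  proof -
    have A: "A \<in> sets ?P" using that by (simp add: sets_coordinate_sigma)
    have inv: "fun_upd \<omega> i x \<in> A \<longleftrightarrow> \<omega> \<in> A" if "\<omega> \<in> space ?P" "x \<in> space D" for \<omega> x
    proof -
      have "fun_upd \<omega> i x \<in> space ?P" using that by (auto simp: space_PiM PiE_iff)
      thus ?thesis
        using \<open>A \<in> sets (?F k)\<close> \<open>k < i\<close> that(1)
        by (intro depends_onD[of "space ?P" "{j. 0 < k \<and> j \<le> k}"]) (auto simp: sets_coordinate_sigma)
    qed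
    have "(LINT \<omega>:A|?P. g (\<omega> 0) (\<omega> i))
      = (\<integral>\<omega>. (\<integral>x. indicator A (fun_upd \<omega> i x) * g (fun_upd \<omega> i x 0) (fun_upd \<omega> i x i) \<partial>D) \<partial>?P)"
      unfolding set_lebesgue_integral_def real_scaleR_def
      by (rule integral_PiM_resample[OF D])
        (use integrable_mult_indicator[OF A int[of i]] \<open>k < i\<close> in simp)
    also have "\<dots> = (\<integral>\<omega>. (\<integral>x. indicator A \<omega> * g (\<omega> 0) x \<partial>D) \<partial>?P)"
      using \<open>k < i\<close> by (intro Bochner_Integration.integral_cong refl) (auto simp: inv indicator_def)
    also have "\<dots> = 0" by (simp add: mean)
    finally show ?thesis .
  qed
  have "AE \<omega> in ?P. real_cond_exp ?P (?F k) (\<lambda>\<omega>. g (\<omega> 0) (\<omega> i)) \<omega> = 0" if "k < i" for k i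
  proof -
    interpret F: finite_measure_subalgebra ?P "?F k"
      by unfold_locales (rule sub)
    \<comment> \<open>The constant 0 is a conditional expectation because, by \<open>zero\<close>,
      it has the right integral over each set of the sub-sigma-algebra.\<close>
    show ?thesis
      using that zero by (intro F.real_cond_exp_charact int) auto
  qed
  moreover have "(\<integral>\<omega>. g (\<omega> 0) (\<omega> i) \<partial>?P) = 0" if "i \<ge> 1" for i
    using zero[of 0 i "space ?P"] that sets.top[of "?F 0"]
    by (simp add: set_integral_space int)
  moreover have "(\<lambda>\<omega>. g (\<omega> 0) (\<omega> i)) \<in> borel_measurable (?F i)" if "i \<ge> 1" for i
    using that int[OF that] by (intro borel_measurable_coordinate_sigma) auto
  moreover have "filtration (space ?P) ?F"
    by unfold_locales (auto simp: sets_coordinate_sigma elim: depends_on_mono)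
  moreover have "sets (?F 0) = {{}, space ?P}"
  proof -
    have "A = {} \<or> A = space ?P" if A: "A \<in> sets (?F 0)" for A
      using A sets.sets_into_space[OF A] by (intro depends_on_empty) (auto simp: sets_coordinate_sigma)
    moreover have "{} \<in> sets (?F 0)" "space (?F 0) \<in> sets (?F 0)" by blast+
    ultimately show ?thesis by auto
  qed
  ultimately show ?thesis
    unfolding martingale_differences_def using P.prob_space_axioms sub int by auto
qed

subsection \<open>The standard exponential distribution\<close>

text \<open>One law serves all coordinates: a threshold turns such a variable into a two-valued one
  of prescribed probability, and its power \<open>1 / q\<close> has tail
  \<open>exp (- (x powr q))\<close>.\<close>

definition std_exp :: "real measure" where
  "std_exp = density lborel (exponential_density 1)"

lemma sets_std_exp [measurable_cong, simp]: "sets std_exp = sets borel"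
  and space_std_exp [simp]: "space std_exp = UNIV"
  by (simp_all add: std_exp_def)

interpretation std_exp: prob_space std_exp
  unfolding std_exp_def by (rule prob_space_exponential_density) simp

lemma distributed_std_exp: "distributed std_exp lborel (\<lambda>x. x) (exponential_density 1)"
  unfolding distributed_def
proof (intro conjI)
  have "distr std_exp lborel (\<lambda>x. x) = std_exp"
    by (rule distr_id2) simp
  thus "distr std_exp lborel (\<lambda>x. x) = density lborel (exponential_density 1)"
    by (simp add: std_exp_def)
qed auto

lemma measure_std_exp_greaterThan:
  assumes "0 \<le> a"
  shows "measure std_exp {a<..} = exp (- a)"
  using std_exp.exponential_distributedD_gt[OF distributed_std_exp assms] by (simp add: greaterThan_def)

lemma measure_std_exp_atLeast:
  assumes "0 \<le> a"
  shows "measure std_exp {a..} = exp (- a)"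
proof -
  have "AE x in std_exp. x \<noteq> a"
    unfolding std_exp_def using AE_lborel_singleton[of a] by (subst AE_density) (auto elim: eventually_mono)
  hence "measure std_exp {a..} = measure std_exp {a<..}"
    by (intro measure_eq_AE) (auto elim: eventually_mono)
  thus ?thesis using assms by (simp add: measure_std_exp_greaterThan)
qed

lemma measure_std_exp_atMost:
  assumes "0 \<le> a"
  shows "measure std_exp {..a} = 1 - exp (- a)"
  using std_exp.exponential_distributedD_le[OF distributed_std_exp assms] by (simp add: atMost_def)

lemma AE_std_exp_nonneg: "AE x in std_exp. 0 \<le> x"
  unfolding std_exp_def by (subst AE_density) (auto simp: exponential_density_def)

lemma integrable_std_exp_power: "integrable std_exp (\<lambda>x. x ^ n)"
  using std_exp.erlang_ith_moment_integrable[OF _ distributed_std_exp] by simp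

lemma std_exp_two_valued:
  fixes c d :: real
  assumes "0 \<le> a"
  shows "integrable std_exp (\<lambda>v. if a < v then c else d)"
    and "(\<integral>v. (if a < v then c else d) \<partial>std_exp) = c * exp (- a) + d * (1 - exp (- a))"
proof -
  have eq: "(\<lambda>v. if a < v then c else d) = (\<lambda>v. (c - d) * indicator {a<..} v + d)"
    by (auto simp: fun_eq_iff)
  show "integrable std_exp (\<lambda>v. if a < v then c else d)"
    unfolding eq by (simp add: std_exp.emeasure_eq_measure)
  show "(\<integral>v. (if a < v then c else d) \<partial>std_exp) = c * exp (- a) + d * (1 - exp (- a))"
    unfolding eq using assms
    by (subst Bochner_Integration.integral_add)
      (auto simp: std_exp.emeasure_eq_measure measure_std_exp_greaterThan std_exp.prob_space[simplified] algebra_simps)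
qed

subsection \<open>Lower tail bounds for the simple random walk\<close>

text \<open>A Paley-Zygmund inequality on \<open>B\<close>: where \<open>Y < c\<close>, the excess
  \<open>Y - c\<close> is negative, so its mean must come from \<open>Y \<ge> c\<close>, and the
  second moment limits what a small event can contribute.\<close>

lemma (in finite_measure) second_moment_bound:
  fixes Y :: "'a \<Rightarrow> real"
  assumes [measurable]: "B \<in> sets M" "Y \<in> borel_measurable M"
    and int1: "integrable M (\<lambda>x. indicator B x * Y x)"
    and int2: "integrable M (\<lambda>x. indicator B x * (Y x)\<^sup>2)"
    and pos: "0 < (\<integral>x. indicator B x * (Y x)\<^sup>2 \<partial>M)"
    and c: "0 \<le> c" "c * measure M B \<le> (\<integral>x. indicator B x * Y x \<partial>M)"
  shows "((\<integral>x. indicator B x * Y x \<partial>M) - c * measure M B)\<^sup>2 / (\<integral>x. indicator B x * (Y x)\<^sup>2 \<partial>M)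
    \<le> measure M {x \<in> space M. x \<in> B \<and> c \<le> Y x}"
proof -
  define m where "m = (\<integral>x. indicator B x * Y x \<partial>M) - c * measure M B"
  define v where "v = (\<integral>x. indicator B x * (Y x)\<^sup>2 \<partial>M)"
  let ?E = "{x \<in> space M. x \<in> B \<and> c \<le> Y x}"
  have v: "v > 0" and m: "m \<ge> 0" using pos c by (auto simp: v_def m_def)
  have E[measurable]: "?E \<in> sets M" by measurable
  have "m\<^sup>2 \<le> v * measure M ?E"
  proof (cases "m = 0")
    case False
    \<comment> \<open>The optimal weight when AM-GM replaces Cauchy-Schwarz: it gives
      \<open>v / (2 * s) = m / 2\<close>, which the left-hand side absorbs.\<close>
    define s where "s = v / m"
    have s: "s > 0" using v m False by (simp add: s_def)
    have amgm: "y \<le> s / 2 + y\<^sup>2 / (2 * s)" for y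
    proof -
      have "0 \<le> (y - s)\<^sup>2 / (2 * s)" using s by simp
      also have "\<dots> = s / 2 + y\<^sup>2 / (2 * s) - y" using s by (simp add: field_simps power2_eq_square)
      finally show ?thesis by simp
    qed
    have pw: "indicator B x * Y x - c * indicator B x
        \<le> s / 2 * indicator ?E x + indicator B x * (Y x)\<^sup>2 / (2 * s)" if "x \<in> space M" for x
    proof (cases "x \<in> B \<and> c \<le> Y x")
      case True
      thus ?thesis using amgm[of "Y x"] c that by simp
    next
      case False
      thus ?thesis using s by (auto simp: indicator_def not_le intro: order_trans[of _ 0])
    qed
    have "m = (\<integral>x. indicator B x * Y x - c * indicator B x \<partial>M)"
      using int1 by (simp add: m_def emeasure_eq_measure)
    also have "\<dots> \<le> (\<integral>x. s / 2 * indicator ?E x + indicator B x * (Y x)\<^sup>2 / (2 * s) \<partial>M)"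
      using pw int1 int2 by (intro integral_mono) (auto simp: emeasure_eq_measure)
    also have "\<dots> = s / 2 * measure M ?E + v / (2 * s)"
      using int2 by (simp add: v_def emeasure_eq_measure)
    finally have "m \<le> s / 2 * measure M ?E + v / (2 * s)" .
    also have "v / (2 * s) = m / 2" using v False by (simp add: s_def)
    finally have "m \<le> s * measure M ?E" by simp
    hence "m * m \<le> m * (s * measure M ?E)" using m by (intro mult_left_mono)
    also have "\<dots> = v * measure M ?E" using False by (simp add: s_def)
    finally show ?thesis by (simp add: power2_eq_square)
  qed (use v in simp)
  thus ?thesis using v unfolding m_def[symmetric] v_def[symmetric] by (simp add: field_simps)
qed

lemma sinh_bounds:
  fixes x :: real
  assumes "0 \<le> x" "x \<le> 1"
  shows "x \<le> sinh x" "sinh x \<le> 2 * x"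
proof -
  have "exp x \<le> 1 + x + x\<^sup>2" using exp_bound assms by simp
  moreover have "1 - x \<le> exp (- x)" using exp_ge_add_one_self[of "-x"] by simp
  moreover have "x\<^sup>2 \<le> x" using assms by (simp add: power2_eq_square mult_left_le)
  ultimately show "sinh x \<le> 2 * x" using assms unfolding sinh_field_def by simp
  show "x \<le> sinh x" using real_le_x_sinh[OF assms(1)] by (simp add: sinh_field_def exp_minus)
qed

text \<open>The identity \<open>cosh x = 1 + 2 * (sinh (x / 2))\<^sup>2\<close> reduces this to
  \<open>y \<le> sinh y\<close>. Here and in the next bound only the order \<open>x\<^sup>2\<close>
  of the exponent matters; the constants are crude.\<close>

lemma cosh_ge_exp:
  fixes x :: real
  assumes "0 \<le> x" "x \<le> 1"
  shows "exp (x\<^sup>2 / 4) \<le> cosh x"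
proof -
  have "x\<^sup>2 \<le> 1" using assms by (simp add: power_le_one)
  hence "exp (x\<^sup>2 / 4) \<le> 1 + x\<^sup>2 / 4 + (x\<^sup>2 / 4)\<^sup>2" by (intro exp_bound) auto
  also have "(x\<^sup>2 / 4)\<^sup>2 \<le> x\<^sup>2 / 4 * 1" unfolding power2_eq_square[of "x\<^sup>2 / 4"]
    using \<open>x\<^sup>2 \<le> 1\<close> by (intro mult_left_mono) auto
  also have "1 + x\<^sup>2 / 4 + x\<^sup>2 / 4 * 1 = 1 + 2 * (x / 2)\<^sup>2" by (simp add: power2_eq_square)
  also have "\<dots> \<le> 1 + 2 * (sinh (x / 2))\<^sup>2"
    using sinh_bounds(1)[of "x / 2"] assms by (intro add_left_mono mult_left_mono power_mono) auto
  also have "\<dots> = cosh (2 * (x / 2))" unfolding cosh_double cosh_square_eq by simp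
  finally show ?thesis by simp
qed

lemma cosh_double_le_exp:
  fixes x :: real
  assumes "0 \<le> x" "x \<le> 1"
  shows "cosh (2 * x) \<le> exp (8 * x\<^sup>2)"
proof -
  have "cosh (2 * x) = 1 + 2 * (sinh x)\<^sup>2" unfolding cosh_double cosh_square_eq by simp
  also have "\<dots> \<le> 1 + 2 * (2 * x)\<^sup>2"
    using sinh_bounds[OF assms] assms by (intro add_left_mono mult_left_mono power_mono) auto
  also have "\<dots> = 1 + 8 * x\<^sup>2" by (simp add: power2_eq_square)
  also have "\<dots> \<le> exp (8 * x\<^sup>2)" by (rule exp_ge_add_one_self)
  finally show ?thesis .
qed

text \<open>A fair sign, since \<open>ln 2\<close> is the median of the standard exponential
  law.\<close>

abbreviation coin :: "real \<Rightarrow> real" where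
  "coin v \<equiv> if ln 2 < v then 1 else - 1"

text \<open>The integrand factors over the coordinates: coordinate 0 contributes
  \<open>exp (- a)\<close>, each coin \<open>cosh t\<close>. Carrying the indicator along treats
  amplitude and walk in one computation.\<close>

lemma exponential_moment_walk:
  fixes a t :: real and n :: nat
  assumes a: "0 \<le> a"
  defines "Z \<equiv> \<lambda>\<omega>. indicator {a<..} (\<omega> 0) * exp (t * (\<Sum>i=1..n. coin (\<omega> i)))"
  shows "integrable (PiM UNIV (\<lambda>_. std_exp)) Z"
    and "(\<integral>\<omega>. Z \<omega> \<partial>PiM UNIV (\<lambda>_. std_exp)) = exp (- a) * cosh t ^ n"
proof -
  define h :: "nat \<Rightarrow> real \<Rightarrow> real" where
    "h i v = (if i = 0 then if a < v then 1 else 0 else if ln 2 < v then exp t else exp (- t))" for i v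
  have h: "integrable std_exp (h i)" for i
    using std_exp_two_valued(1)[OF a] std_exp_two_valued(1)[of "ln 2"] by (cases "i = 0") (auto simp: h_def[abs_def])
  have I0: "integral\<^sup>L std_exp (h 0) = exp (- a)"
    using std_exp_two_valued(2)[OF a, of 1 0] by (simp add: h_def[abs_def])
  have Ii: "integral\<^sup>L std_exp (h i) = cosh t" if "i > 0" for i
    using std_exp_two_valued(2)[of "ln 2" "exp t" "exp (- t)"] that
    by (simp add: h_def[abs_def] exp_minus[of "ln 2"] cosh_field_def field_simps)
  have Z: "Z \<omega> = (\<Prod>i\<in>{0..n}. h i (\<omega> i))" for \<omega>
  proof -
    have "exp (t * (\<Sum>i=1..n. coin (\<omega> i))) = (\<Prod>i=1..n. h i (\<omega> i))"
      unfolding sum_distrib_left by (subst exp_sum) (auto simp: h_def intro!: prod.cong)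
    thus ?thesis
      by (simp add: Z_def prod.atLeast_Suc_atMost[of 0 n] h_def[of 0] indicator_def)
  qed
  show "integrable (PiM UNIV (\<lambda>_. std_exp)) Z"
    unfolding Z[abs_def] by (rule integral_PiM_prod_coordinates(1)) (use h std_exp.prob_space_axioms in auto)
  have "(\<integral>\<omega>. Z \<omega> \<partial>PiM UNIV (\<lambda>_. std_exp)) = (\<Prod>i\<in>{0..n}. integral\<^sup>L std_exp (h i))"
    unfolding Z[abs_def] by (rule integral_PiM_prod_coordinates(2)) (use h std_exp.prob_space_axioms in auto)
  also have "\<dots> = exp (- a) * cosh t ^ n"
    by (simp add: prod.atLeast_Suc_atMost[of 0 n] I0 Ii)
  finally show "(\<integral>\<omega>. Z \<omega> \<partial>PiM UNIV (\<lambda>_. std_exp)) = exp (- a) * cosh t ^ n" .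
qed

text \<open>The second moment bound is applied to \<open>Y\<close>, the exponential of
  \<open>t\<close> times the walk, on the event \<open>a < \<omega> 0\<close>. Up to the common
  factor \<open>exp (- a)\<close>, the first moment is at least
  \<open>exp (n * t\<^sup>2 / 4)\<close> and the second at most
  \<open>exp (8 * (n * t\<^sup>2))\<close>.\<close>

lemma walk_tail_lower_bound:
  fixes a t :: real and n :: nat
  assumes a: "0 \<le> a" and t: "0 < t" "t \<le> 1"
  shows "exp (- a) * (1 - exp (- (n * t\<^sup>2 / 8)))\<^sup>2 * exp (- (8 * (n * t\<^sup>2)))
    \<le> measure (PiM UNIV (\<lambda>_. std_exp))
        {\<omega> \<in> space (PiM UNIV (\<lambda>_. std_exp)). a < \<omega> 0 \<and> n * t / 8 \<le> (\<Sum>i=1..n. coin (\<omega> i))}"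
proof -
  let ?P = "PiM UNIV (\<lambda>_::nat. std_exp)"
  interpret P: product_prob_space "\<lambda>_::nat. std_exp" UNIV by unfold_locales
  define B where "B = {\<omega> \<in> space ?P. a < \<omega> 0}"
  define Y where "Y \<omega> = exp (t * (\<Sum>i=1..n. coin (\<omega> i)))" for \<omega> :: "nat \<Rightarrow> real"
  \<comment> \<open>The square root of the lower bound for \<open>cosh t ^ n\<close>, hence below
    the mean of \<open>Y\<close> given \<open>B\<close>.\<close>
  define c where "c = exp (n * t\<^sup>2 / 8)"
  have [measurable]: "B \<in> sets ?P" "Y \<in> borel_measurable ?P"
    unfolding B_def Y_def by measurable
  have ind: "indicator B \<omega> = (indicator {a<..} (\<omega> 0) :: real)" if "\<omega> \<in> space ?P" for \<omega>
    using that by (simp add: B_def indicator_def)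
  have Y2: "(Y \<omega>)\<^sup>2 = exp (2 * t * (\<Sum>i=1..n. coin (\<omega> i)))" for \<omega>
    by (simp add: Y_def exp_double mult.assoc)
  have B: "measure ?P B = exp (- a)"
  proof -
    have "measure ?P B = (\<integral>\<omega>. indicator B \<omega> \<partial>?P)" by simp
    also have "\<dots> = (\<integral>\<omega>. indicator {a<..} (\<omega> 0) \<partial>?P)"
      by (intro Bochner_Integration.integral_cong ind refl)
    \<comment> \<open>At \<open>t = 0\<close> the exponential factor is 1.\<close>
    also have "\<dots> = exp (- a)" using exponential_moment_walk(2)[OF a, of 0 n] by simp
    finally show ?thesis .
  qed
  have int1: "integrable ?P (\<lambda>\<omega>. indicator B \<omega> * Y \<omega>)"
    and E1: "(\<integral>\<omega>. indicator B \<omega> * Y \<omega> \<partial>?P) = exp (- a) * cosh t ^ n"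
    using exponential_moment_walk[OF a, of t n] unfolding Y_def
    by (auto simp: ind cong: Bochner_Integration.integral_cong Bochner_Integration.integrable_cong)
  have int2: "integrable ?P (\<lambda>\<omega>. indicator B \<omega> * (Y \<omega>)\<^sup>2)"
    and E2: "(\<integral>\<omega>. indicator B \<omega> * (Y \<omega>)\<^sup>2 \<partial>?P) = exp (- a) * cosh (2 * t) ^ n"
    using exponential_moment_walk[OF a, of "2 * t" n] unfolding Y2
    by (auto simp: ind cong: Bochner_Integration.integral_cong Bochner_Integration.integrable_cong)
  have ge: "exp (n * t\<^sup>2 / 4) \<le> cosh t ^ n"
    using power_mono[OF cosh_ge_exp, of t n] t by (simp add: exp_of_nat_mult[symmetric])
  have le: "cosh (2 * t) ^ n \<le> exp (8 * (n * t\<^sup>2))"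
    using power_mono[OF cosh_double_le_exp, of t n] t by (simp add: exp_of_nat_mult[symmetric] mult.left_commute)
  have "(1 - exp (- (n * t\<^sup>2 / 8))) * 1 \<le> (1 - exp (- (n * t\<^sup>2 / 8))) * exp (n * t\<^sup>2 / 4)"
    by (intro mult_left_mono) auto
  also have "\<dots> = exp (n * t\<^sup>2 / 4) - c"
    by (simp add: c_def algebra_simps flip: exp_add)
  finally have diff: "1 - exp (- (n * t\<^sup>2 / 8)) \<le> cosh t ^ n - c" using ge by simp
  have d0: "0 \<le> 1 - exp (- (n * t\<^sup>2 / 8))" by simp
  have "c \<le> cosh t ^ n" using diff d0 by linarith
  hence c: "c * measure ?P B \<le> exp (- a) * cosh t ^ n" by (simp add: B)
  have "exp (- a) * (1 - exp (- (n * t\<^sup>2 / 8)))\<^sup>2 * exp (- (8 * (n * t\<^sup>2)))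
     \<le> exp (- a) * (cosh t ^ n - c)\<^sup>2 * inverse (cosh (2 * t) ^ n)"
    using diff d0 le t unfolding exp_minus[of "8 * (n * t\<^sup>2)"]
    by (intro mult_mono power_mono le_imp_inverse_le) (auto simp: cosh_real_pos)
  also have "\<dots> = (exp (- a) * cosh t ^ n - c * exp (- a))\<^sup>2 / (exp (- a) * cosh (2 * t) ^ n)"
    by (simp add: field_simps power2_eq_square)
  also have "\<dots> \<le> measure ?P {\<omega> \<in> space ?P. \<omega> \<in> B \<and> c \<le> Y \<omega>}"
    using P.second_moment_bound[of B Y c] int1 int2 c
    by (simp add: E1 E2 B c_def cosh_real_pos)
  also have "\<dots> = measure ?P {\<omega> \<in> space ?P. a < \<omega> 0 \<and> n * t / 8 \<le> (\<Sum>i=1..n. coin (\<omega> i))}"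
  proof -
    have "c \<le> Y \<omega> \<longleftrightarrow> n * t / 8 \<le> (\<Sum>i=1..n. coin (\<omega> i))" for \<omega>
    proof -
      have "c \<le> Y \<omega> \<longleftrightarrow> t * (n * t / 8) \<le> t * (\<Sum>i=1..n. coin (\<omega> i))"
        unfolding c_def Y_def exp_le_cancel_iff by (simp add: power2_eq_square mult_ac)
      thus ?thesis using t by (simp only: mult_le_cancel_left_pos)
    qed
    thus ?thesis by (simp add: B_def conj_assoc)
  qed
  finally show ?thesis .
qed

subsection \<open>The heavy-tailed martingale\<close>

locale tail_construction =
  fixes q x0 :: real
  assumes q: "q > 0" and x0: "x0 > 0"
begin

text \<open>
  With \<open>\<omega> 0\<close> standard exponential, the shift by \<open>ln 2\<close> gives \<open>P (\<eta> (\<omega> 0) \<ge> x) = 2 exp (- x\<^sup>q)\<close>;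
  the factor 2 pays for the coin. The cut \<open>A\<close> and the threshold \<open>b\<close> are such that
  \<open>\<omega> 0 \<le> A\<close> and \<open>\<omega> i > b\<close> both have probability \<open>p\<close>, where \<open>p\<^sup>2 = exp (- x0\<^sup>q)\<close>.
\<close>

definition b where "b = x0 powr q / 2"
definition p where "p = exp (- b)"
definition A where "A = - ln (1 - p)"
definition \<eta> where "\<eta> u = (u + ln 2) powr (1 / q)"
text \<open>Levels from \<open>K\<close> on are reached through the random amplitude, lower ones
  through the two-valued branch. The value of \<open>L\<close> centres that branch:
  \<open>K * p = L * (1 - p)\<close>.\<close>

definition K where "K = \<eta> A"
definition L where "L = K * p / (1 - p)"
definition g where "g u v = (if A < u then \<eta> u * coin v else if b < v then K else - L)"

lemma b_pos: "0 < b" using x0 by (simp add: b_def)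

lemma p: "0 < p" "p < 1" using b_pos by (simp_all add: p_def)

lemma A_pos: "0 < A" and exp_A: "exp (- A) = 1 - p"
  using p by (simp_all add: A_def)

lemma \<eta>_nonneg: "0 \<le> \<eta> u" by (simp add: \<eta>_def)

lemma K_pos: "0 < K"
proof -
  have "0 < A + ln 2" using A_pos by (simp add: add_pos_pos)
  thus ?thesis by (simp add: K_def \<eta>_def)
qed

lemma L_pos: "0 < L" using K_pos p by (simp add: L_def)

lemma le_\<eta>_iff:
  assumes "0 \<le> x" "0 \<le> u"
  shows "x \<le> \<eta> u \<longleftrightarrow> x powr q - ln 2 \<le> u"
proof -
  have u: "0 \<le> u + ln 2" using assms by simp
  have "x \<le> \<eta> u \<longleftrightarrow> x powr q \<le> \<eta> u powr q"
    using q assms(1) \<eta>_nonneg[of u] powr_mono2[of q x "\<eta> u"] powr_less_mono2[of q "\<eta> u" x]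
    by (meson less_eq_real_def not_less)
  also have "\<eta> u powr q = u + ln 2" using q u by (simp add: \<eta>_def powr_powr)
  finally show ?thesis by auto
qed

text \<open>By monotonicity of \<open>\<eta>\<close>, the threshold that \<open>\<omega> 0\<close>
  must pass to reach such a level is not below the cut, so passing it strictly selects the branch
  with random amplitude.\<close>

lemma A_le: "K \<le> x \<Longrightarrow> A \<le> x powr q - ln 2"
  using le_\<eta>_iff[of x A] le_\<eta>_iff[of K A] A_pos K_pos powr_mono2[of q K x] q
  by (simp add: K_def \<eta>_def powr_powr add_nonneg_nonneg)

lemma measurable_g [measurable]:
  "(\<lambda>\<omega>. g (\<omega> 0) (\<omega> i)) \<in> borel_measurable (PiM UNIV (\<lambda>_::nat. std_exp))"
  unfolding g_def \<eta>_def by measurable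

lemma g_mean: "(\<integral>v. g u v \<partial>std_exp) = 0"
proof (cases "A < u")
  case True
  have "(\<integral>v. coin v \<partial>std_exp) = 0"
    using std_exp_two_valued(2)[of "ln 2" 1 "-1"] by (simp add: exp_minus)
  thus ?thesis using True by (simp add: g_def)
next
  case False
  thus ?thesis using std_exp_two_valued(2)[of b K "- L"] b_pos p
    by (simp add: g_def L_def flip: p_def)
qed

lemma integrable_g: "integrable (PiM UNIV (\<lambda>_::nat. std_exp)) (\<lambda>\<omega>. g (\<omega> 0) (\<omega> i))"
proof -
  \<comment> \<open>A natural exponent of at least \<open>1 / q\<close> bounds \<open>\<eta>\<close>
    by a polynomial, which is integrable under the exponential law.\<close>
  define m where "m = nat \<lceil>1 / q\<rceil>"
  have m: "1 / q \<le> real m" unfolding m_def by linarith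
  interpret P: product_prob_space "\<lambda>_::nat. std_exp" UNIV by unfold_locales
  have "integrable std_exp (\<lambda>u. (u + 1) ^ m)"
    unfolding binomial_ring using integrable_std_exp_power by simp
  hence "integrable (PiM UNIV (\<lambda>_::nat. std_exp)) (\<lambda>\<omega>. (\<omega> 0 + 1) ^ m)"
    using integral_PiM_prod_coordinates(1)[of std_exp "{0}" "\<lambda>_ u. (u + 1) ^ m"]
      std_exp.prob_space_axioms by simp
  hence int: "integrable (PiM UNIV (\<lambda>_::nat. std_exp)) (\<lambda>\<omega>. K + L + (\<omega> 0 + 1) ^ m)" by simp
  have "AE \<omega> in PiM UNIV (\<lambda>_::nat. std_exp). 0 \<le> \<omega> 0"
    by (rule AE_PiM_component) (use AE_std_exp_nonneg std_exp.prob_space_axioms in auto)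
  hence "AE \<omega> in PiM UNIV (\<lambda>_::nat. std_exp). norm (g (\<omega> 0) (\<omega> i)) \<le> norm (K + L + (\<omega> 0 + 1) ^ m)"
  proof eventually_elim
    case (elim \<omega>)
    have "\<eta> (\<omega> 0) \<le> (\<omega> 0 + 1) powr (1 / q)"
      unfolding \<eta>_def using elim q ln_le_minus_one[of 2] by (intro powr_mono2) auto
    also have "\<dots> \<le> (\<omega> 0 + 1) powr m" using elim m by (intro powr_mono) auto
    also have "\<dots> = (\<omega> 0 + 1) ^ m" using elim by (simp add: powr_realpow)
    finally have "\<eta> (\<omega> 0) \<le> (\<omega> 0 + 1) ^ m" .
    thus ?case using K_pos L_pos \<eta>_nonneg[of "\<omega> 0"] by (auto simp: g_def)
  qed
  thus ?thesis by (intro Bochner_Integration.integrable_bound[OF int]) auto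
qed

text \<open>The right tail suffices. For \<open>x \<ge> K\<close>, a large amplitude and a positive
  coin have probability \<open>2 * exp (- (x powr q)) / 2\<close>; for smaller \<open>x\<close>, the
  value \<open>K\<close> of the two-valued branch has probability
  \<open>p * p = exp (- (x0 powr q))\<close>.\<close>

lemma tail_lower:
  assumes i: "1 \<le> i" and x: "x0 \<le> x"
  shows "exp (- (x powr q)) \<le> tail (PiM UNIV (\<lambda>_::nat. std_exp)) (\<lambda>\<omega>. g (\<omega> 0) (\<omega> i)) x"
proof -
  let ?P = "PiM UNIV (\<lambda>_::nat. std_exp)"
  interpret P: product_prob_space "\<lambda>_::nat. std_exp" UNIV by unfold_locales
  have prob: "measure ?P {\<omega> \<in> space ?P. \<omega> 0 \<in> S \<and> \<omega> i \<in> T} = measure std_exp S * measure std_exp T"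
    if "S \<in> sets borel" "T \<in> sets borel" for S T
    using i that by (intro prob_PiM_two_coordinates std_exp.prob_space_axioms) auto
  have "exp (- (x powr q)) \<le> measure ?P {\<omega> \<in> space ?P. x \<le> g (\<omega> 0) (\<omega> i)}"
  proof (cases "K \<le> x")
    case True
    define a where "a = x powr q - ln 2"
    have a: "A \<le> a" using A_le[OF True] by (simp add: a_def)
    have "exp (- (x powr q)) = exp (- a) * exp (- ln 2)" by (simp add: a_def flip: exp_add)
    also have "\<dots> = measure ?P {\<omega> \<in> space ?P. \<omega> 0 \<in> {a<..} \<and> \<omega> i \<in> {ln 2<..}}"
      using a A_pos by (subst prob) (auto simp: measure_std_exp_greaterThan)
    also have "\<dots> \<le> measure ?P {\<omega> \<in> space ?P. x \<le> g (\<omega> 0) (\<omega> i)}"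
    proof (rule P.finite_measure_mono)
      show "{\<omega> \<in> space ?P. \<omega> 0 \<in> {a<..} \<and> \<omega> i \<in> {ln 2<..}} \<subseteq> {\<omega> \<in> space ?P. x \<le> g (\<omega> 0) (\<omega> i)}"
        using a A_pos x x0 by (auto simp: g_def le_\<eta>_iff a_def)
    qed measurable
    finally show ?thesis .
  next
    case False
    have "exp (- (x powr q)) \<le> exp (- (x0 powr q))" using q x x0 by (simp add: powr_mono2)
    also have "\<dots> = p * p" by (simp add: p_def b_def flip: exp_add)
    also have "\<dots> = measure ?P {\<omega> \<in> space ?P. \<omega> 0 \<in> {..A} \<and> \<omega> i \<in> {b<..}}"
      using A_pos b_pos by (subst prob) (auto simp: measure_std_exp_greaterThan measure_std_exp_atMost exp_A p_def)
    also have "\<dots> \<le> measure ?P {\<omega> \<in> space ?P. x \<le> g (\<omega> 0) (\<omega> i)}"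
    proof (rule P.finite_measure_mono)
      show "{\<omega> \<in> space ?P. \<omega> 0 \<in> {..A} \<and> \<omega> i \<in> {b<..}} \<subseteq> {\<omega> \<in> space ?P. x \<le> g (\<omega> 0) (\<omega> i)}"
        using False by (auto simp: g_def)
    qed measurable
    finally show ?thesis .
  qed
  thus ?thesis by (simp add: tail_def)
qed

text \<open>Up to \<open>K + L\<close> the constant absorbs the trivial bound 1. Beyond it the
  values \<open>K\<close> and \<open>- L\<close> are too small in modulus, so the amplitude itself
  must reach \<open>x\<close>.\<close>

lemma tail_upper:
  assumes x: "0 < x"
  shows "tail (PiM UNIV (\<lambda>_::nat. std_exp)) (\<lambda>\<omega>. g (\<omega> 0) (\<omega> i)) x
    \<le> (2 + exp ((K + L) powr q)) * exp (- (x powr q))"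
proof -
  let ?P = "PiM UNIV (\<lambda>_::nat. std_exp)" and ?T = "tail (PiM UNIV (\<lambda>_::nat. std_exp)) (\<lambda>\<omega>. g (\<omega> 0) (\<omega> i)) x"
  interpret P: product_prob_space "\<lambda>_::nat. std_exp" UNIV by unfold_locales
  show ?thesis
  proof (cases "x \<le> K + L")
    case True
    have "?T \<le> 1" by (simp add: tail_def)
    also have "\<dots> \<le> exp ((K + L) powr q) * exp (- (x powr q))"
      using True x q by (simp add: powr_mono2 flip: exp_add)
    also have "\<dots> \<le> (2 + exp ((K + L) powr q)) * exp (- (x powr q))" by (intro mult_right_mono) auto
    finally show ?thesis .
  next
    case False
    define a where "a = x powr q - ln 2"
    have "0 \<le> a" using A_le[of x] A_pos False L_pos by (simp add: a_def)
    \<comment> \<open>Coordinate 1 is a dummy that brings the event into two-coordinate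
      form.\<close>
    hence "measure ?P {\<omega> \<in> space ?P. \<omega> 0 \<in> {a..} \<and> \<omega> 1 \<in> UNIV} = exp (- a)"
      using std_exp.prob_space
      by (subst prob_PiM_two_coordinates) (auto intro: std_exp.prob_space_axioms simp: measure_std_exp_atLeast)
    hence *: "measure ?P {\<omega> \<in> space ?P. a \<le> \<omega> 0} = 2 * exp (- (x powr q))"
      by (simp add: a_def exp_diff exp_minus field_simps)
    have g: "a \<le> u" if "x \<le> g u v \<or> g u v \<le> - x" for u v
    proof -
      have "A < u" using that False K_pos L_pos x by (auto simp: g_def split: if_splits)
      moreover from this have "x \<le> \<eta> u" using that x \<eta>_nonneg[of u] by (auto simp: g_def split: if_splits)
      ultimately show ?thesis using x A_pos by (simp add: le_\<eta>_iff a_def)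
    qed
    have "?T \<le> measure ?P {\<omega> \<in> space ?P. a \<le> \<omega> 0}"
      unfolding tail_def by (intro max.boundedI P.finite_measure_mono) (auto intro: g)
    also have "\<dots> \<le> (2 + exp ((K + L) powr q)) * exp (- (x powr q))"
      unfolding * by (intro mult_right_mono) auto
    finally show ?thesis .
  qed
qed

text \<open>The scale \<open>r\<close> balances two costs: an amplitude of order \<open>r\<close>
  costs \<open>r powr q = N\<close> in the exponent, and a walk of order \<open>n / r\<close> costs
  \<open>n / r\<^sup>2\<close>, which is also \<open>N\<close>.\<close>

lemma Q_lower:
  assumes n: "1 \<le> n"
  shows "2 * (1 - exp (- 1 / 8))\<^sup>2 * exp (- ((9 + K) powr q + 8) * real n powr (q / (q + 2)))
    \<le> Q (PiM UNIV (\<lambda>_::nat. std_exp)) (\<lambda>i \<omega>. g (\<omega> 0) (\<omega> i)) n 1"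
proof -
  let ?P = "PiM UNIV (\<lambda>_::nat. std_exp)"
  interpret P: product_prob_space "\<lambda>_::nat. std_exp" UNIV by unfold_locales
  define r where "r = real n powr (1 / (q + 2))"
  define N where "N = real n powr (q / (q + 2))"
  \<comment> \<open>The 9 exceeds the 8 of the walk bound, which makes the final inequality strict;
    adding \<open>K\<close> ensures \<open>K \<le> x\<close>, as \<open>r \<ge> 1\<close>.\<close>
  define x where "x = (9 + K) * r"
  define a where "a = x powr q - ln 2"
  have r: "1 \<le> r" unfolding r_def using n q by (intro ge_one_powr_ge_zero) auto
  have N1: "1 \<le> N" unfolding N_def using n q by (intro ge_one_powr_ge_zero) auto
  have rq: "r powr q = N" by (simp add: r_def N_def powr_powr)
  have N: "n * (1 / r)\<^sup>2 = N"
  proof -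
    have "r\<^sup>2 = r powr 2" using r by simp
    hence "N * r\<^sup>2 = real n powr (q / (q + 2) + 2 / (q + 2))"
      by (simp add: N_def r_def powr_add powr_powr)
    also have "q / (q + 2) + 2 / (q + 2) = 1" using q by (simp flip: add_divide_distrib)
    finally show ?thesis using n r by (simp add: field_simps power2_eq_square)
  qed
  have "K * 1 \<le> (9 + K) * r" using r K_pos by (intro mult_mono) auto
  hence "K \<le> x" by (simp add: x_def)
  hence a: "A \<le> a" using A_le by (simp add: a_def)
  have xq: "x powr q = (9 + K) powr q * N"
    using r K_pos by (simp add: x_def powr_mult rq)
  have x8: "8 * r < x" using r K_pos unfolding x_def by (intro mult_strict_right_mono) auto
  have "2 * (1 - exp (- 1 / 8))\<^sup>2 * exp (- ((9 + K) powr q + 8) * N)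
    = exp (- a) * (1 - exp (- 1 / 8))\<^sup>2 * exp (- (8 * N))"
    by (simp add: a_def xq exp_diff exp_minus exp_add algebra_simps)
  \<comment> \<open>Since \<open>N \<ge> 1\<close>, the prefactor is bounded below uniformly in
    \<open>n\<close>.\<close>
  also have "\<dots> \<le> exp (- a) * (1 - exp (- (N / 8)))\<^sup>2 * exp (- (8 * N))"
    using N1 by (intro mult_right_mono mult_left_mono power_mono) auto
  also have "\<dots> \<le> measure ?P {\<omega> \<in> space ?P. a < \<omega> 0 \<and> n * (1 / r) / 8 \<le> (\<Sum>i=1..n. coin (\<omega> i))}"
    using walk_tail_lower_bound[of a "1 / r" n] a A_pos r unfolding N by simp
  also have "\<dots> \<le> Q ?P (\<lambda>i \<omega>. g (\<omega> 0) (\<omega> i)) n 1"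
    unfolding Q_def mart_sum_def
  proof (intro P.finite_measure_mono subsetI CollectI conjI)
    fix \<omega> assume \<omega>: "\<omega> \<in> {\<omega> \<in> space ?P. a < \<omega> 0 \<and> n * (1 / r) / 8 \<le> (\<Sum>i=1..n. coin (\<omega> i))}"
    thus "\<omega> \<in> space ?P" by simp
    have A: "A < \<omega> 0" using \<omega> a by simp
    have \<eta>: "x \<le> \<eta> (\<omega> 0)" using \<omega> a A_pos \<open>K \<le> x\<close> K_pos by (simp add: le_\<eta>_iff a_def)
    have "real n = 8 * r * (n * (1 / r) / 8)" using r by simp
    also have "\<dots> < x * (n * (1 / r) / 8)" using x8 n r by (intro mult_strict_right_mono) auto
    also have "\<dots> \<le> \<eta> (\<omega> 0) * (\<Sum>i=1..n. coin (\<omega> i))"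
      using \<omega> \<eta> \<eta>_nonneg r by (intro mult_mono) auto
    also have "\<dots> = (\<Sum>i=1..n. g (\<omega> 0) (\<omega> i))"
      using A by (simp add: g_def sum_distrib_left)
    finally show "1 < (\<Sum>i=1..n. g (\<omega> 0) (\<omega> i)) / real n" using n by simp
  qed measurable
  finally show ?thesis by (simp add: N_def)
qed

end

theorem theorem3p1:
  fixes q x0 :: real
  assumes "q > 0" and "x0 > 0"
  shows "\<exists>(M :: (nat \<Rightarrow> real) measure) F \<xi>.
    martingale_differences M F \<xi> \<and>
    (\<exists>C1>0.
      (\<forall>x\<ge>x0. (INF i\<in>{1..}. tail M (\<xi> i) x) \<ge> exp (- (x powr q))) \<and>
      (\<forall>x>0. (SUP i\<in>{1..}. tail M (\<xi> i) x) \<le> C1 * exp (- (x powr q)))) \<and>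
    (\<exists>C2>0. \<exists>C3>0. \<forall>n\<ge>1.
      Q M \<xi> n 1 \<ge> C2 * exp (- C3 * real n powr (q / (q + 2))))"
proof -
  interpret tail_construction q x0 using assms by unfold_locales
  let ?P = "PiM UNIV (\<lambda>_::nat. std_exp)" and ?\<xi> = "\<lambda>i \<omega>. g (\<omega> 0) (\<omega> (i::nat))"
  let ?C1 = "2 + exp ((K + L) powr q)"
  let ?C2 = "2 * (1 - exp (- 1 / 8 :: real))\<^sup>2" and ?C3 = "(9 + K) powr q + 8"
  have "martingale_differences ?P (\<lambda>k. coordinate_sigma ?P {j. 0 < k \<and> j \<le> k}) ?\<xi>"
    by (intro martingale_differences_iid std_exp.prob_space_axioms integrable_g g_mean)
  moreover have "?C1 > 0" by (simp add: add_pos_pos)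
  \<comment> \<open>The tail bounds are uniform in \<open>i\<close>, so they pass to the infimum and
    supremum over the nonempty index set.\<close>
  moreover have "\<forall>x\<ge>x0. exp (- (x powr q)) \<le> (INF i\<in>{1..}. tail ?P (?\<xi> i) x)"
    by (auto intro!: cINF_greatest tail_lower)
  moreover have "\<forall>x>0. (SUP i\<in>{1..}. tail ?P (?\<xi> i) x) \<le> ?C1 * exp (- (x powr q))"
    by (auto intro!: cSUP_least tail_upper)
  moreover have "?C2 > 0" by simp
  moreover have "?C3 > 0" by (simp add: add_nonneg_pos)
  moreover have "\<forall>n\<ge>1. ?C2 * exp (- ?C3 * real n powr (q / (q + 2))) \<le> Q ?P ?\<xi> n 1"
    using Q_lower by blast
  ultimately show ?thesis by blast
qed

end
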